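(* Let $G(z,u)=\sum_{n\ge1} g_n(u) z^n$ be a bivariate power series with positive coefficients such that $\frac{g_{n-1}(1)}{g_n(1)} = O(n^{-\sigma})$ for some $\sigma>0$. Let $F(z,u,y)=\sum_{i\ge0}\sum_{j\ge0} f_{i,j}(u) z^i y^j$ be a power series with $f_{0,1}(1)=1$, such that $F(z,1,y)$ represents a function analytic at the origin. Let $X_n$ be the random variables with probability generating function $$p_n(u)=\frac{[z^n]F(z,u,G(z,u))}{[z^n]F(z,1,G(z,1))},$$ and let $Y_n$ be the random variables with probability generating function $q_n(u)=\frac{[z^n]G(z,u)}{[z^n]G(z,1)}$. If $Y_n\xrightarrow{D} Y$, then $X_n \xrightarrow{D} Y$.
   Context: $[z^n]$ denotes coefficient extraction in $z$.
   Formalization: The claim fails as stated; added: Σ_{k=r}^{n-r} g_k(1)g_{n-k}(1) = o(g_n(1)) for some r; F converges absolutely at some (r',1,s) with r',s>0; and f_{0,1}(u)=1 identically, or, with only f_{0,1}(1)=1, convergence of (Y_n-a_n)/b_n to that of (X_n-a_n)/b_n, b_n→∞. *)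

theory Defs
  imports "HOL-Probability.Probability"
    "HOL-Computational_Algebra.Formal_Power_Series"
    "HOL-Library.Landau_Symbols"
begin

text \<open>
  A bivariate series \<open>G(z,u)\<close> is a \<^typ>\<open>real fps fps\<close>: the outer variable is \<open>z\<close>, the inner one
  \<open>u\<close>.  The trivariate series \<open>F(z,u,y)\<close> is the array of its coefficients
  \<open>f\<^sub>i\<^sub>,\<^sub>j(u)\<close>, each a \<^typ>\<open>real fps\<close> in \<open>u\<close>.
\<close>

definition eval_u1 :: "real fps fps \<Rightarrow> real fps" where
  "eval_u1 G = Abs_fps (\<lambda>n. eval_fps (fps_nth G n) 1)"

text \<open>
  The substitution \<open>y := g(z)\<close> in \<open>\<Sum>\<^sub>i\<^sub>,\<^sub>j f i j z^i y^j\<close>, for \<open>g\<close> without constant term.  Then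
  \<open>z^i g^j\<close> has order at least \<open>i + j\<close>, so the terms with \<open>i > n\<close> or \<open>j > n\<close> do not contribute to
  the coefficient of \<open>z^n\<close>.
\<close>

definition subst_y :: "(nat \<Rightarrow> nat \<Rightarrow> 'a::comm_ring_1) \<Rightarrow> 'a fps \<Rightarrow> 'a fps" where
  "subst_y f g = Abs_fps (\<lambda>n. \<Sum>i\<le>n. \<Sum>j\<le>n. f i j * fps_nth (g ^ j) (n - i))"

definition q_pgf :: "real fps fps \<Rightarrow> nat \<Rightarrow> real fps" where
  "q_pgf G n = fps_const (1 / fps_nth (eval_u1 G) n) * fps_nth G n"

definition p_denom :: "(nat \<Rightarrow> nat \<Rightarrow> real fps) \<Rightarrow> real fps fps \<Rightarrow> nat \<Rightarrow> real" where
  "p_denom F G n = fps_nth (subst_y (\<lambda>i j. eval_fps (F i j) 1) (eval_u1 G)) n"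

definition p_pgf :: "(nat \<Rightarrow> nat \<Rightarrow> real fps) \<Rightarrow> real fps fps \<Rightarrow> nat \<Rightarrow> real fps" where
  "p_pgf F G n = fps_const (1 / p_denom F G n) * fps_nth (subst_y F G) n"

text \<open>
  \<open>F(z,1,y)\<close> is analytic at the origin, in the sense that \<open>F\<close>, as a series in all three variables,
  converges absolutely at \<open>(r,1,s)\<close> for some \<open>r, s > 0\<close>.  If \<open>F\<close> has nonnegative coefficients, this
  says exactly that the double series \<open>\<Sum>\<^sub>i\<^sub>,\<^sub>j f\<^sub>i\<^sub>,\<^sub>j(1) z^i y^j\<close> converges near the origin.  For
  coefficients of mixed sign, cancellation within \<open>f\<^sub>i\<^sub>,\<^sub>j(1)\<close> is thereby excluded: analyticity of the
  double series alone would say nothing about the size of the \<open>f\<^sub>i\<^sub>,\<^sub>j(u)\<close>.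
\<close>

definition analytic_at_u1 :: "(nat \<Rightarrow> nat \<Rightarrow> real fps) \<Rightarrow> bool" where
  "analytic_at_u1 F \<longleftrightarrow>
     (\<exists>r>0. \<exists>s>0. (\<lambda>(i, j, k). \<bar>fps_nth (F i j) k\<bar> * r ^ i * s ^ j) summable_on UNIV)"

definition has_pgf :: "'a measure \<Rightarrow> ('a \<Rightarrow> nat) \<Rightarrow> real fps \<Rightarrow> bool" where
  "has_pgf M X p \<longleftrightarrow> prob_space M \<and> X \<in> measurable M (count_space UNIV) \<and>
     (\<forall>k. measure M {\<omega> \<in> space M. X \<omega> = k} = fps_nth p k)"

definition converges_in_distribution ::
    "(nat \<Rightarrow> 'a measure) \<Rightarrow> (nat \<Rightarrow> 'a \<Rightarrow> real) \<Rightarrow> 'b measure \<Rightarrow> ('b \<Rightarrow> real) \<Rightarrow> bool" where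
  "converges_in_distribution M X N Y \<longleftrightarrow>
     weak_conv_m (\<lambda>n. distr (M n) borel (X n)) (distr N borel Y)"

end

theory Submission
  imports Defs
begin

text \<open>
  Write \<open>g\<^sub>n = g\<^sub>n(1)\<close>.  The growth conditions give \<open>[z^n] g^2 = o(g\<^sub>n)\<close>, and then, as in Bender's
  theorem, all terms of \<open>[z^n] F(z,u,G(z,u))\<close> except \<open>f\<^sub>0\<^sub>,\<^sub>1(u) g\<^sub>n(u)\<close> together have \<open>l\<^sup>1\<close>-norm \<open>o(g\<^sub>n)\<close>
  as power series in \<open>u\<close>.  So \<open>p\<^sub>n(u) = f\<^sub>0\<^sub>,\<^sub>1(u) q\<^sub>n(u) + o(1)\<close> uniformly on the unit disc.  At
  \<open>u = exp(it/b\<^sub>n)\<close> the factor \<open>f\<^sub>0\<^sub>,\<^sub>1(u)\<close>, a series of possibly mixed sign, tends to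
  \<open>f\<^sub>0\<^sub>,\<^sub>1(1) = 1\<close>, so the characteristic functions of \<open>X\<^sub>n\<close> and \<open>Y\<^sub>n\<close> have the same limit, and
  Levy's continuity theorem applies.
\<close>

section \<open>Absolutely summable power series\<close>

text \<open>The bound on the l1 norm is phrased through partial sums, so that summability is part of
  the statement and needs no separate side condition.\<close>

definition l1_bound :: "real fps \<Rightarrow> real \<Rightarrow> bool" where
  "l1_bound f B \<longleftrightarrow> (\<forall>K. (\<Sum>k<K. \<bar>fps_nth f k\<bar>) \<le> B)"

lemma l1_bound_nonneg: "l1_bound f B \<Longrightarrow> 0 \<le> B"
  unfolding l1_bound_def by (drule spec[of _ 0]) simp

lemma l1_bound_mono: "l1_bound f B \<Longrightarrow> B \<le> C \<Longrightarrow> l1_bound f C"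
  unfolding l1_bound_def by (meson order_trans)

lemma l1_bound_summable: "l1_bound f B \<Longrightarrow> summable (\<lambda>k. \<bar>fps_nth f k\<bar>)"
  unfolding l1_bound_def by (rule summableI_nonneg_bounded[where x = B]) auto

lemma l1_bound_suminf_le: "l1_bound f B \<Longrightarrow> (\<Sum>k. \<bar>fps_nth f k\<bar>) \<le> B"
  using l1_bound_summable[of f B] suminf_le_const unfolding l1_bound_def by blast

lemma l1_boundI_suminf:
  assumes "summable (\<lambda>k. \<bar>fps_nth f k\<bar>)" "(\<Sum>k. \<bar>fps_nth f k\<bar>) \<le> B"
  shows "l1_bound f B"
  unfolding l1_bound_def
proof
  fix K
  have "(\<Sum>k<K. \<bar>fps_nth f k\<bar>) \<le> (\<Sum>k. \<bar>fps_nth f k\<bar>)"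
    using assms(1) by (intro sum_le_suminf) auto
  then show "(\<Sum>k<K. \<bar>fps_nth f k\<bar>) \<le> B" using assms(2) by linarith
qed

lemma l1_bound_0: "l1_bound 0 0"
  by (simp add: l1_bound_def)

lemma l1_bound_1: "l1_bound 1 1"
proof -
  have "(\<Sum>k<K. \<bar>fps_nth (1::real fps) k\<bar>) = (if K = 0 then 0 else 1)" for K
    by (induction K) auto
  then show ?thesis by (simp add: l1_bound_def)
qed

lemma l1_bound_add:
  assumes "l1_bound f A" "l1_bound g B"
  shows "l1_bound (f + g) (A + B)"
  unfolding l1_bound_def
proof
  fix K
  have "(\<Sum>k<K. \<bar>fps_nth (f + g) k\<bar>) \<le> (\<Sum>k<K. \<bar>fps_nth f k\<bar> + \<bar>fps_nth g k\<bar>)"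
    by (intro sum_mono) (auto intro: abs_triangle_ineq)
  also have "\<dots> \<le> A + B"
    using assms unfolding l1_bound_def sum.distrib by (intro add_mono) auto
  finally show "(\<Sum>k<K. \<bar>fps_nth (f + g) k\<bar>) \<le> A + B" .
qed

lemma l1_bound_sum:
  "(\<And>x. x \<in> I \<Longrightarrow> l1_bound (f x) (B x)) \<Longrightarrow> l1_bound (sum f I) (sum B I)"
  by (induction I rule: infinite_finite_induct) (auto intro: l1_bound_0 l1_bound_add)

text \<open>The coefficients of a product are dominated by the Cauchy product of the absolute
  values, and the sum of that product factors.\<close>

lemma l1_bound_mult:
  assumes f: "l1_bound f A" and g: "l1_bound g B"
  shows "l1_bound (f * g) (A * B)"
  unfolding l1_bound_def
proof
  fix K
  define h where "h k = (\<Sum>i\<le>k. \<bar>fps_nth f i\<bar> * \<bar>fps_nth g (k - i)\<bar>)" for k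
  have h: "h sums ((\<Sum>k. \<bar>fps_nth f k\<bar>) * (\<Sum>k. \<bar>fps_nth g k\<bar>))"
    unfolding h_def using f g
    by (intro Cauchy_product_sums) (auto dest: l1_bound_summable)
  have "\<bar>fps_nth (f * g) k\<bar> \<le> h k" for k
    unfolding fps_mult_nth h_def abs_mult[symmetric] atMost_atLeast0 by (rule sum_abs)
  then have "(\<Sum>k<K. \<bar>fps_nth (f * g) k\<bar>) \<le> (\<Sum>k<K. h k)"
    by (intro sum_mono)
  also have "\<dots> \<le> suminf h"
    using sums_summable[OF h] by (rule sum_le_suminf) (auto simp: h_def intro!: sum_nonneg)
  also have "\<dots> = (\<Sum>k. \<bar>fps_nth f k\<bar>) * (\<Sum>k. \<bar>fps_nth g k\<bar>)"
    using h by (simp add: sums_iff)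
  also have "\<dots> \<le> A * B"
    using f g by (intro mult_mono l1_bound_suminf_le suminf_nonneg l1_bound_summable)
      (auto dest: l1_bound_nonneg)
  finally show "(\<Sum>k<K. \<bar>fps_nth (f * g) k\<bar>) \<le> A * B" .
qed

text \<open>Majorant principle: a coefficient of \<open>G ^ j\<close> is a polynomial with
  nonnegative coefficients in those of \<open>G\<close>, so each of these may be replaced by its
  bound. This reduces estimates of series in u to estimates of real numbers.\<close>

lemma l1_bound_power_nth:
  fixes G :: "real fps fps" and g :: "real fps"
  assumes "\<And>n. l1_bound (fps_nth G n) (fps_nth g n)"
  shows "l1_bound (fps_nth (G ^ j) n) (fps_nth (g ^ j) n)"
proof (induction j arbitrary: n)
  case 0
  then show ?case by (auto simp: l1_bound_0 l1_bound_1)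
next
  case (Suc j)
  then show ?case
    unfolding power_Suc fps_mult_nth by (intro l1_bound_sum l1_bound_mult assms)
qed

section \<open>Evaluation of real series on the closed complex unit disc\<close>

definition ceval :: "real fps \<Rightarrow> complex \<Rightarrow> complex" where
  "ceval f z = (\<Sum>k. of_real (fps_nth f k) * z ^ k)"

lemma norm_ceval_term_le:
  "norm z \<le> 1 \<Longrightarrow> norm (of_real (fps_nth f k) * z ^ k :: complex) \<le> \<bar>fps_nth f k\<bar>"
  by (simp add: norm_mult norm_power mult_left_le power_le_one)

lemma ceval_summable:
  assumes "l1_bound f B" "norm z \<le> 1"
  shows "summable (\<lambda>k. norm (of_real (fps_nth f k) * z ^ k :: complex))"
  by (rule summable_comparison_test'[OF l1_bound_summable[OF assms(1)], of 0])
     (use norm_ceval_term_le[OF assms(2)] in auto)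

lemma norm_ceval_le:
  assumes "l1_bound f B" "norm z \<le> 1"
  shows "norm (ceval f z) \<le> B"
proof -
  have "norm (ceval f z) \<le> (\<Sum>k. norm (of_real (fps_nth f k) * z ^ k :: complex))"
    unfolding ceval_def by (rule summable_norm[OF ceval_summable[OF assms]])
  also have "\<dots> \<le> (\<Sum>k. \<bar>fps_nth f k\<bar>)"
    by (intro suminf_le norm_ceval_term_le ceval_summable[OF assms] l1_bound_summable[OF assms(1)] assms)
  also have "\<dots> \<le> B" by (rule l1_bound_suminf_le[OF assms(1)])
  finally show ?thesis .
qed

lemma ceval_add:
  assumes "l1_bound f A" "l1_bound g B" "norm z \<le> 1"
  shows "ceval (f + g) z = ceval f z + ceval g z"
  unfolding ceval_def
  using suminf_add[OF ceval_summable[OF assms(1,3), THEN summable_norm_cancel]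
      ceval_summable[OF assms(2,3), THEN summable_norm_cancel]]
  by (simp add: distrib_right)

lemma ceval_mult:
  assumes "l1_bound f A" "l1_bound g B" "norm z \<le> 1"
  shows "ceval (f * g) z = ceval f z * ceval g z"
proof -
  have "(of_real (fps_nth f i) * z ^ i) * (of_real (fps_nth g (k - i)) * z ^ (k - i))
          = of_real (fps_nth f i * fps_nth g (k - i)) * z ^ k" if "i \<le> k" for i k
    using power_add[of z i "k - i"] that by simp
  then have "of_real (fps_nth (f * g) k) * z ^ k
      = (\<Sum>i\<le>k. (of_real (fps_nth f i) * z ^ i) * (of_real (fps_nth g (k - i)) * z ^ (k - i)))" for k
    unfolding fps_mult_nth of_real_sum sum_distrib_right atMost_atLeast0
    by (intro sum.cong) (auto simp del: of_real_mult)
  then show ?thesis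
    unfolding ceval_def
    using Cauchy_product[OF ceval_summable[OF assms(1,3)] ceval_summable[OF assms(2,3)]]
    by simp
qed

lemma ceval_const_mult:
  assumes "l1_bound f B" "norm z \<le> 1"
  shows "ceval (fps_const c * f) z = of_real c * ceval f z"
  unfolding ceval_def
  using suminf_mult[OF ceval_summable[OF assms, THEN summable_norm_cancel], of "of_real c"]
  by (simp add: mult.assoc)

lemma ceval_1:
  assumes "l1_bound f B"
  shows "ceval f 1 = of_real (eval_fps f 1)"
proof -
  have "summable (fps_nth f)"
    using l1_bound_summable[OF assms] by (rule summable_rabs_cancel)
  then show ?thesis
    by (simp add: ceval_def eval_fps_def suminf_of_real)
qed

text \<open>The M-test with the absolute coefficients as majorants gives uniform convergence up to
  the unit circle. The boundary matters: characteristic functions evaluate the series on the circle,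
  at points approaching 1.\<close>

lemma continuous_on_ceval:
  assumes "l1_bound f B"
  shows "continuous_on (cball 0 1) (ceval f)"
proof -
  have "uniform_limit (cball 0 1) (\<lambda>n z. \<Sum>k<n. of_real (fps_nth f k) * z ^ k) (ceval f) sequentially"
    unfolding ceval_def
    by (rule Weierstrass_m_test[OF norm_ceval_term_le l1_bound_summable[OF assms]]) auto
  then show ?thesis
    by (rule uniform_limit_theorem[rotated]) (auto intro!: continuous_intros always_eventually)
qed

lemma abs_eval_fps_le: "l1_bound f B \<Longrightarrow> \<bar>eval_fps f 1\<bar> \<le> B"
  using norm_ceval_le[of f B 1] ceval_1[of f B] by simp

section \<open>Characteristic functions\<close>

lemma has_pgf_normalized_rv:
  assumes "has_pgf M X p"
  shows "prob_space M \<and> (\<lambda>\<omega>. (real (X \<omega>) - a) / b) \<in> borel_measurable M"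
proof -
  have [measurable]: "X \<in> measurable M (count_space UNIV)" using assms by (simp add: has_pgf_def)
  have "(\<lambda>\<omega>. (real (X \<omega>) - a) / b) \<in> borel_measurable M" by measurable
  then show ?thesis using assms by (simp add: has_pgf_def)
qed

text \<open>At the value k the integrand is a phase coming from \<open>a\<close> times the k-th
  power of \<open>iexp (t / b)\<close>, so the expectation is a power series. The case
  \<open>b = 0\<close> is included: as x / 0 = 0, both sides are then 1.\<close>

lemma char_distr_has_pgf:
  assumes "has_pgf M X p"
  shows "char (distr M borel (\<lambda>\<omega>. (real (X \<omega>) - a) / b)) t
           = iexp (- (t * a / b)) * ceval p (iexp (t / b))"
proof -
  interpret prob_space M using assms by (simp add: has_pgf_def)
  have X[measurable]: "X \<in> measurable M (count_space UNIV)" using assms by (simp add: has_pgf_def)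
  define D where "D = distr M (count_space UNIV) X"
  interpret D: prob_space D unfolding D_def by (rule prob_space_distr) simp
  have m: "measure D {k} = fps_nth p k" for k
    using assms by (simp add: D_def measure_distr has_pgf_def vimage_def Int_def conj_commute)
  \<comment> \<open>The law of \<open>X\<close> has density \<open>p\<close> against counting
    measure, which turns the expectation into a series.\<close>
  have D: "D = density (count_space UNIV) (\<lambda>k. ennreal (fps_nth p k))"
  proof (rule measure_eqI_countable[of _ UNIV])
    fix k :: nat
    show "emeasure D {k} = emeasure (density (count_space UNIV) (\<lambda>k. ennreal (fps_nth p k))) {k}"
      by (subst emeasure_density)
        (auto simp: D.emeasure_eq_measure m nn_integral_count_space_indicator[symmetric]
          nn_integral_count_space_finite)
  qed (auto simp: D_def)
  have nn: "0 \<le> fps_nth p k" for k using m[of k] by (metis measure_nonneg)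
  let ?h = "\<lambda>k. iexp (t * ((real k - a) / b))"
  have "char (distr M borel (\<lambda>\<omega>. (real (X \<omega>) - a) / b)) t = (CLINT \<omega>|M. ?h (X \<omega>))"
    unfolding char_def by (subst integral_distr) auto
  also have "\<dots> = (CLINT k|D. ?h k)"
    unfolding D_def by (subst integral_distr) auto
  also have "\<dots> = (CLINT k|count_space UNIV. fps_nth p k *\<^sub>R ?h k)"
    unfolding D by (rule integral_density) (auto simp: nn)
  also have "\<dots> = (\<Sum>k. fps_nth p k *\<^sub>R ?h k)"
  proof (rule integral_count_space_nat)
    have "integrable D ?h"
      by (rule D.integrable_const_bound[where B = 1]) (auto simp: D_def)
    then show "integrable (count_space UNIV) (\<lambda>k. fps_nth p k *\<^sub>R ?h k)"
      unfolding D by (subst (asm) integrable_density) (auto simp: nn)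
  qed
  also have "\<dots> = (\<Sum>k. iexp (- (t * a / b)) * (of_real (fps_nth p k) * iexp (t / b) ^ k))"
  proof (rule suminf_cong)
    fix k
    have "?h k = iexp (- (t * a / b)) * iexp (t / b) ^ k"
      by (simp add: exp_of_nat_mult[symmetric] exp_add[symmetric] diff_divide_distrib algebra_simps)
    then show "fps_nth p k *\<^sub>R ?h k = iexp (- (t * a / b)) * (of_real (fps_nth p k) * iexp (t / b) ^ k)"
      by (simp add: scaleR_conv_of_real)
  qed
  also have "\<dots> = iexp (- (t * a / b)) * ceval p (iexp (t / b))"
  proof -
    \<comment> \<open>Summability of the probabilities is read off from integrability of the
      constant 1 under the law.\<close>
    have s: "summable (fps_nth p)"
    proof -
      have "integrable D (\<lambda>k. 1 :: real)" by simp
      then have "integrable (count_space UNIV) (\<lambda>k. fps_nth p k *\<^sub>R (1::real))"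
        unfolding D by (subst (asm) integrable_density) (auto simp: nn)
      then show ?thesis
        using sums_integral_count_space_nat[of "fps_nth p"] by (simp add: sums_iff)
    qed
    then have "summable (\<lambda>k. of_real (fps_nth p k) * iexp (t / b) ^ k)"
      by (intro summable_norm_cancel[OF summable_comparison_test'[OF s, of 0]])
         (auto simp: norm_mult norm_power nn)
    then show ?thesis unfolding ceval_def by (rule suminf_mult)
  qed
  finally show ?thesis .
qed

lemma converges_in_distribution_iff_char:
  assumes M: "\<forall>\<^sub>F n in sequentially. prob_space (M n) \<and> X n \<in> borel_measurable (M n)"
    and N: "prob_space N" "Y \<in> borel_measurable N"
  shows "converges_in_distribution M X N Y \<longleftrightarrow>
    (\<forall>t. (\<lambda>n. char (distr (M n) borel (X n)) t) \<longlonglongrightarrow> char (distr N borel Y) t)"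
proof -
  \<comment> \<open>Finitely many of the \<open>M n\<close> may fail to be probability spaces, which Levy's theorem does not allow.\<close>
  define D where "D n = (if prob_space (M n) \<and> X n \<in> borel_measurable (M n)
    then distr (M n) borel (X n) else distr N borel Y)" for n
  have N': "real_distribution (distr N borel Y)"
    using N by (rule prob_space.real_distribution_distr)
  have D': "real_distribution (D n)" for n
    unfolding D_def using N' by (auto intro: prob_space.real_distribution_distr)
  have D: "\<forall>\<^sub>F n in sequentially. distr (M n) borel (X n) = D n"
    using M by eventually_elim (simp add: D_def)
  have "converges_in_distribution M X N Y \<longleftrightarrow> weak_conv_m D (distr N borel Y)"
    unfolding converges_in_distribution_def weak_conv_m_def weak_conv_def
    by (intro all_cong1 imp_cong refl tendsto_cong, use D in eventually_elim) simp
  also have "\<dots> \<longleftrightarrow> (\<forall>t. (\<lambda>n. char (D n) t) \<longlonglongrightarrow> char (distr N borel Y) t)"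
    using levy_continuity1[of D, OF D' N'] levy_continuity[of D, OF D' N'] by blast
  also have "\<dots> \<longleftrightarrow> (\<forall>t. (\<lambda>n. char (distr (M n) borel (X n)) t) \<longlonglongrightarrow> char (distr N borel Y) t)"
    by (intro all_cong1 tendsto_cong, use D in eventually_elim) simp
  finally show ?thesis .
qed

section \<open>Coefficients of powers of a rapidly growing series\<close>

lemma power_nth_nonneg:
  fixes g :: "real fps"
  assumes "\<And>n. fps_nth g n \<ge> 0"
  shows "fps_nth (g ^ j) n \<ge> 0"
proof (induction j arbitrary: n)
  case (Suc j)
  then show ?case unfolding power_Suc fps_mult_nth using assms by (intro sum_nonneg mult_nonneg_nonneg)
qed auto

text \<open>The quotient telescopes into k consecutive ratios, each tending to 0. The cancellation
  is only eventual, since \<open>g (n - k)\<close> is known to be nonzero only for n > k.\<close>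

lemma ratio_shift_tendsto_0:
  fixes g :: "nat \<Rightarrow> real"
  assumes ratio: "(\<lambda>n. g (n - 1) / g n) \<longlonglongrightarrow> 0"
    and pos: "\<And>n. n \<ge> 1 \<Longrightarrow> g n > 0" and k: "k \<ge> 1"
  shows "(\<lambda>n. g (n - k) / g n) \<longlonglongrightarrow> 0"
  using k
proof (induction k rule: dec_induct)
  case (step k)
  have "(\<lambda>n. g ((n - k) - 1) / g (n - k)) \<longlonglongrightarrow> 0"
    using ratio by (rule filterlim_compose) (rule filterlim_minus_const_nat_at_top)
  from tendsto_mult[OF this step.IH]
  have "(\<lambda>n. g ((n - k) - 1) / g (n - k) * (g (n - k) / g n)) \<longlonglongrightarrow> 0" by simp
  moreover have "\<forall>\<^sub>F n in sequentially.
      g ((n - k) - 1) / g (n - k) * (g (n - k) / g n) = g (n - Suc k) / g n"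
    using eventually_gt_at_top[of k]
    by eventually_elim (use pos in \<open>auto simp: less_imp_neq[symmetric]\<close>)
  ultimately show ?case by (rule Lim_transform_eventually)
qed (use ratio in simp)

text \<open>The convolution splits into r terms at either end and the middle. An end term is a fixed
  \<open>g\<close> coefficient times a shifted ratio that tends to 0; the middle is negligible by
  hypothesis.\<close>

lemma convolution_square_smallo:
  fixes g :: "real fps"
  assumes g0: "fps_nth g 0 = 0" and pos: "\<And>n. n \<ge> 1 \<Longrightarrow> fps_nth g n > 0"
    and ratio: "(\<lambda>n. fps_nth g (n - 1) / fps_nth g n) \<longlonglongrightarrow> 0"
    and middle: "(\<lambda>n. \<Sum>k = r..n - r. fps_nth g k * fps_nth g (n - k)) \<in> o(\<lambda>n. fps_nth g n)"
  shows "(\<lambda>n. fps_nth (g\<^sup>2) n / fps_nth g n) \<longlonglongrightarrow> 0"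
proof -
  let ?g = "fps_nth g"
  define m where "m n = (\<Sum>k = r..n - r. ?g k * ?g (n - k))" for n
  define e where "e n = (\<Sum>k<r. ?g k * ?g (n - k))" for n
  have m: "(\<lambda>n. m n / ?g n) \<longlonglongrightarrow> 0"
    using smalloD_tendsto[OF middle] by (simp add: m_def)
  have "(\<lambda>n. \<Sum>k<r. ?g k * (?g (n - k) / ?g n)) \<longlonglongrightarrow> 0"
  proof (intro tendsto_null_sum)
    fix k
    show "(\<lambda>n. ?g k * (?g (n - k) / ?g n)) \<longlonglongrightarrow> 0"
    \<comment> \<open>At k = 0 the ratio is eventually 1 and does not tend to 0; this term
      disappears because \<open>g\<close> has no constant term.\<close>
    proof (cases "k = 0")
      case False
      then show ?thesis
        by (intro tendsto_mult_right_zero ratio_shift_tendsto_0[OF ratio pos]) auto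
    qed (simp add: g0)
  qed
  then have e: "(\<lambda>n. e n / ?g n) \<longlonglongrightarrow> 0"
    by (simp add: e_def sum_divide_distrib)
  from tendsto_add[OF tendsto_add[OF e e] m]
  have "(\<lambda>n. e n / ?g n + e n / ?g n + m n / ?g n) \<longlonglongrightarrow> 0" by simp
  moreover have "\<forall>\<^sub>F n in sequentially.
      e n / ?g n + e n / ?g n + m n / ?g n = fps_nth (g\<^sup>2) n / ?g n"
    using eventually_ge_at_top[of "2 * r"]
  proof eventually_elim
    case (elim n)
    let ?t = "\<lambda>k. ?g k * ?g (n - k)"
    have "fps_nth (g\<^sup>2) n = sum ?t {0..n}"
      by (simp add: power2_eq_square fps_mult_nth)
    \<comment> \<open>From n = 2r on, the three ranges are disjoint and cover everything; the
      reflection k to n - k identifies the two ends.\<close>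
    also have "{0..n} = ({..<r} \<union> {n-r<..n}) \<union> {r..n-r}"
      using elim by auto
    also have "sum ?t \<dots> = sum ?t {..<r} + sum ?t {n-r<..n} + sum ?t {r..n-r}"
      using elim by (subst sum.union_disjoint; (subst sum.union_disjoint)?) auto
    also have "sum ?t {n-r<..n} = sum ?t {..<r}"
      using elim by (intro sum.reindex_bij_witness[of _ "\<lambda>k. n - k" "\<lambda>k. n - k"]) auto
    finally show ?case by (simp add: e_def m_def add_divide_distrib)
  qed
  ultimately show ?thesis by (rule Lim_transform_eventually)
qed

text \<open>Consecutive terms have quotient x times the ratio, eventually below 1/2, so even their
  series converges. Thus \<open>g\<close> outgrows every geometric sequence.\<close>

lemma power_div_tendsto_0:
  fixes g :: "nat \<Rightarrow> real"
  assumes ratio: "(\<lambda>n. g (n - 1) / g n) \<longlonglongrightarrow> 0" and pos: "\<And>n. n \<ge> 1 \<Longrightarrow> g n > 0"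
    and x: "x > 0"
  shows "(\<lambda>n. x ^ n / g n) \<longlonglongrightarrow> 0"
proof -
  have "\<forall>\<^sub>F n in sequentially. g (n - 1) / g n < 1 / (2 * x)"
    using x by (intro order_tendstoD(2)[OF ratio]) simp
  then obtain N where N: "\<And>n. n \<ge> N \<Longrightarrow> g (n - 1) / g n < 1 / (2 * x)"
    by (auto simp: eventually_sequentially)
  have "norm (x ^ Suc n / g (Suc n)) \<le> 1 / 2 * norm (x ^ n / g n)" if "n \<ge> Suc N" for n
  proof -
    have "g n / g (Suc n) < 1 / (2 * x)" "g n > 0" "g (Suc n) > 0"
      using N[of "Suc n"] pos[of n] pos[of "Suc n"] that by auto
    then have "2 * x * g n \<le> g (Suc n)" using x by (simp add: field_simps)
    then have "x ^ n * (2 * x * g n) \<le> x ^ n * g (Suc n)" using x by (intro mult_left_mono) auto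
    then show ?thesis
      using x \<open>g n > 0\<close> \<open>g (Suc n) > 0\<close> by (simp add: field_simps)
  qed
  then show ?thesis
    by (intro summable_LIMSEQ_zero summable_ratio_test[of "1/2" "Suc N"]) auto
qed

text \<open>
  The base \<open>s\<close> may be arbitrarily small: since \<open>g ^ j\<close> has order at least \<open>j\<close>, for large \<open>j\<close>
  only those \<open>n\<close> matter for which the coefficient of \<open>g\<^sup>2\<close> is at most \<open>s\<close> times that of \<open>g\<close>.
\<close>

lemma power_nth_le:
  fixes g :: "real fps"
  assumes g0: "fps_nth g 0 = 0" and pos: "\<And>n. n \<ge> 1 \<Longrightarrow> fps_nth g n > 0"
    and sq: "(\<lambda>n. fps_nth (g\<^sup>2) n / fps_nth g n) \<longlonglongrightarrow> 0"
    and s: "s > 0"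
  obtains K where "K > 0"
    "\<And>j n. fps_nth (g ^ Suc j) n \<le> K * s ^ j * fps_nth g n"
    "\<And>j n. fps_nth (g ^ Suc (Suc j)) n \<le> K * s ^ j * fps_nth (g\<^sup>2) n"
proof -
  have nn: "fps_nth g n \<ge> 0" for n using g0 pos[of n] by (cases "n = 0") auto
  have nn': "fps_nth (g ^ j) n \<ge> 0" for j n by (rule power_nth_nonneg[OF nn])
  have sq_0: "fps_nth (g\<^sup>2) 0 = 0" by (simp add: power2_eq_square g0)
  obtain n0 where n0: "\<And>n. n \<ge> n0 \<Longrightarrow> fps_nth (g\<^sup>2) n / fps_nth g n < s"
    using order_tendstoD(2)[OF sq s] by (auto simp: eventually_sequentially)
  obtain B where B: "B > 0" "\<And>n. norm (fps_nth (g\<^sup>2) n / fps_nth g n) \<le> B"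
    using convergent_imp_Bseq[OF convergentI[OF sq]] by (auto elim: BseqE)
  \<comment> \<open>\<open>C * s\<close> is a crude factor valid for every n, while \<open>s\<close>
    itself works only from \<open>n0\<close> on. The maximum with 1 makes the powers of
    \<open>C\<close> monotone.\<close>
  define C where "C = max (B / s) 1"
  have C: "C \<ge> 1" "B \<le> C * s" using s by (auto simp: C_def field_simps max_def)
  have C_le: "fps_nth (g\<^sup>2) n \<le> C * s * fps_nth g n" for n
  proof (cases "n = 0")
    case False
    have "fps_nth (g\<^sup>2) n / fps_nth g n \<le> C * s"
      using abs_le_D1[OF B(2)[of n, unfolded real_norm_def]] C(2) by linarith
    then show ?thesis using pos[of n] False by (simp add: field_simps)
  qed (simp add: sq_0 g0)
  have s_le: "fps_nth (g\<^sup>2) n \<le> s * fps_nth g n" if "n \<ge> n0" for n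
  proof (cases "n = 0")
    case False
    then show ?thesis using n0[OF that] pos[of n] by (simp add: field_simps)
  qed (simp add: sq_0 g0)
  \<comment> \<open>One more multiplication by \<open>g\<close> turns a bound by \<open>g\<close>
    into a bound by the convolution \<open>g\<^sup>2\<close>.\<close>
  have step: "fps_nth (g ^ Suc (Suc j)) n \<le> A * fps_nth (g\<^sup>2) n"
    if "\<And>n. fps_nth (g ^ Suc j) n \<le> A * fps_nth g n" for A j n
  proof -
    have "fps_nth (g ^ Suc (Suc j)) n = (\<Sum>k=0..n. fps_nth g k * fps_nth (g ^ Suc j) (n - k))"
      by (subst power_Suc) (simp only: fps_mult_nth)
    also have "\<dots> \<le> (\<Sum>k=0..n. fps_nth g k * (A * fps_nth g (n - k)))"
      by (intro sum_mono mult_left_mono that nn)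
    also have "\<dots> = A * fps_nth (g\<^sup>2) n"
      by (simp add: power2_eq_square fps_mult_nth sum_distrib_left mult_ac)
    finally show ?thesis .
  qed
  \<comment> \<open>The crude factor \<open>C\<close> is paid at most \<open>n0\<close> times. Once
    j has reached \<open>n0\<close>, either n is at least \<open>n0\<close> and the factor
    \<open>s\<close> suffices, or n is below the order of the power and its coefficient is
    0.\<close>
  have main: "fps_nth (g ^ Suc j) n \<le> C ^ min j n0 * s ^ j * fps_nth g n" for j n
  proof (induction j arbitrary: n)
    case (Suc j)
    have A: "0 \<le> C ^ min j n0 * s ^ j" using C s by simp
    have 1: "fps_nth (g ^ Suc (Suc j)) n \<le> C ^ min j n0 * s ^ j * fps_nth (g\<^sup>2) n"
      using Suc.IH by (rule step)
    consider "j < n0" | "n0 \<le> j" "n0 \<le> n" | "n < n0" "n0 \<le> j" by linarith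
    then show ?case
    proof cases
      case 1
      have "C ^ min j n0 * s ^ j * fps_nth (g\<^sup>2) n \<le> C ^ min j n0 * s ^ j * (C * s * fps_nth g n)"
        by (intro mult_left_mono C_le A)
      also have "\<dots> = C ^ min (Suc j) n0 * s ^ Suc j * fps_nth g n"
        using 1 by (simp add: min_def)
      finally show ?thesis using \<open>fps_nth (g ^ Suc (Suc j)) n \<le> _\<close> by linarith
    next
      case 2
      have "C ^ min j n0 * s ^ j * fps_nth (g\<^sup>2) n \<le> C ^ min j n0 * s ^ j * (s * fps_nth g n)"
        by (intro mult_left_mono s_le A 2)
      also have "\<dots> = C ^ min (Suc j) n0 * s ^ Suc j * fps_nth g n"
        using 2 by (simp add: min_def)
      finally show ?thesis using 1 by linarith
    next
      case 3
      then have "fps_nth (g ^ Suc (Suc j)) n = 0"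
        using startsby_zero_power_prefix[OF g0, of "Suc (Suc j)"] by simp
      then show ?thesis using C s nn[of n] by simp
    qed
  qed simp
  show thesis
  proof (rule that[of "C ^ n0"])
    show "C ^ n0 > 0" using C by simp
    show le: "fps_nth (g ^ Suc j) n \<le> C ^ n0 * s ^ j * fps_nth g n" for j n
    proof -
      have "C ^ min j n0 * s ^ j * fps_nth g n \<le> C ^ n0 * s ^ j * fps_nth g n"
        using C s nn by (intro mult_right_mono power_increasing) auto
      then show ?thesis using main[of j n] by linarith
    qed
    show "fps_nth (g ^ Suc (Suc j)) n \<le> C ^ n0 * s ^ j * fps_nth (g\<^sup>2) n" for j n
      by (rule step) (rule le)
  qed
qed

text \<open>
  A factor \<open>z ^ i\<close> is absorbed by \<open>1 \<le> M * x ^ i * g\<^sub>i\<close>, which turns \<open>g\<^sub>n\<^sub>-\<^sub>i\<close> into a term of the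
  convolution \<open>g\<^sup>2\<close>.  The summand \<open>(1 / x) ^ n\<close> takes care of \<open>j = 0\<close>.
\<close>

lemma shifted_power_nth_le:
  fixes g :: "real fps"
  assumes g0: "fps_nth g 0 = 0" and pos: "\<And>n. n \<ge> 1 \<Longrightarrow> fps_nth g n > 0"
    and ratio: "(\<lambda>n. fps_nth g (n - 1) / fps_nth g n) \<longlonglongrightarrow> 0"
    and sq: "(\<lambda>n. fps_nth (g\<^sup>2) n / fps_nth g n) \<longlonglongrightarrow> 0"
    and x: "x > 0" and s: "s > 0"
  obtains L where "L > 0" "\<And>i j n. n \<ge> 1 \<Longrightarrow> i \<le> n \<Longrightarrow> (i, j) \<noteq> (0, 1) \<Longrightarrow>
      fps_nth (g ^ j) (n - i) \<le> L * (x ^ i * s ^ j) * (fps_nth (g\<^sup>2) n + (1 / x) ^ n)"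
proof -
  have nn: "fps_nth g n \<ge> 0" for n using g0 pos[of n] by (cases "n = 0") auto
  have sqnn: "fps_nth (g\<^sup>2) n \<ge> 0" for n by (rule power_nth_nonneg[OF nn])
  obtain K where K: "K > 0"
    "\<And>j n. fps_nth (g ^ Suc j) n \<le> K * s ^ j * fps_nth g n"
    "\<And>j n. fps_nth (g ^ Suc (Suc j)) n \<le> K * s ^ j * fps_nth (g\<^sup>2) n"
    by (rule power_nth_le[OF g0 pos sq s]) (assumption, rule that)
  have "(\<lambda>n. (1 / x) ^ n / fps_nth g n) \<longlonglongrightarrow> 0"
    using x by (intro power_div_tendsto_0 ratio pos) auto
  then have "Bseq (\<lambda>n. (1 / x) ^ n / fps_nth g n)"
    by (intro convergent_imp_Bseq convergentI)
  then obtain M where M: "M > 0" "\<And>n. norm ((1 / x) ^ n / fps_nth g n) \<le> M"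
    by (auto elim: BseqE)
  have M_le: "1 \<le> M * x ^ n * fps_nth g n" if "n \<ge> 1" for n
    using M(2)[of n] pos[OF that] x by (simp add: field_simps)
  \<comment> \<open>The summands are the constants of the cases below: 1 when j = 0 or i = n,
    \<open>K / s\<^sup>2\<close> when i = 0 and j is at least 2, and \<open>K * M / s\<close>
    otherwise. The divisions by \<open>s\<close> compensate for the lower exponents in the bounds
    from \<open>K\<close>.\<close>
  define L where "L = 1 + K / s\<^sup>2 + K * M / s"
  have L: "L > 0" "1 \<le> L" "K / s\<^sup>2 \<le> L" "K * M / s \<le> L"
    using K(1) M(1) s by (auto simp: L_def add_pos_pos)
  show thesis
  proof (rule that[OF L(1)])
    fix i j n :: nat assume n: "n \<ge> 1" and i: "i \<le> n" and ij: "(i, j) \<noteq> (0, 1)"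
    let ?d = "fps_nth (g\<^sup>2) n + (1 / x) ^ n"
    have d: "fps_nth (g\<^sup>2) n \<le> ?d" "(1 / x) ^ n \<le> ?d" "0 \<le> ?d"
      using x sqnn[of n] by auto
    have fin: "fps_nth (g ^ j) (n - i) \<le> L * (x ^ i * s ^ j) * ?d"
      if "fps_nth (g ^ j) (n - i) \<le> c * (x ^ i * s ^ j) * e" "c \<le> L" "e \<le> ?d" "0 \<le> e"
      for c e
    proof -
      have "c * (x ^ i * s ^ j) * e \<le> L * (x ^ i * s ^ j) * ?d"
        using that L x s by (intro mult_mono mult_right_mono) auto
      with that(1) show ?thesis by linarith
    qed
    consider "j = 0" | "j \<ge> 1" "i = n" | "i = 0" "j \<ge> 2" | "j \<ge> 1" "1 \<le> i" "i < n"
      using i ij by (cases "j = 0"; cases "j = 1") (simp; linarith)+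
    then show "fps_nth (g ^ j) (n - i) \<le> L * (x ^ i * s ^ j) * ?d"
    proof cases
      \<comment> \<open>Here \<open>g ^ 0 = 1\<close>, so only i = n contributes, and then 1 is the
        product of \<open>x ^ n\<close> and \<open>(1 / x) ^ n\<close>.\<close>
      case 1
      show ?thesis
        by (rule fin[of 1 "(1 / x) ^ n"]) (use 1 i x d L in \<open>auto simp: power_one_over\<close>)
    next
      case 2
      show ?thesis
        by (rule fin[of 1 0]) (use 2 startsby_zero_power_prefix[OF g0, of j] d L in auto)
    next
      case 3
      then obtain j' where j: "j = Suc (Suc j')" by (metis Suc_le_D numeral_2_eq_2 Suc_le_mono)
      show ?thesis
        by (rule fin[of "K / s\<^sup>2" "fps_nth (g\<^sup>2) n"])
           (use 3 j s d L K(3)[of j' n] sqnn in \<open>auto simp: power2_eq_square\<close>)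
    next
      case 4
      then obtain j' where j: "j = Suc j'" by (cases j) auto
      have "fps_nth g i * fps_nth g (n - i) \<le> (\<Sum>k=0..n. fps_nth g k * fps_nth g (n - k))"
        using i nn by (intro member_le_sum) auto
      then have le: "fps_nth g i * fps_nth g (n - i) \<le> fps_nth (g\<^sup>2) n"
        by (simp add: power2_eq_square fps_mult_nth)
      have "fps_nth (g ^ j) (n - i) \<le> K * s ^ j' * (1 * fps_nth g (n - i))"
        using K(2)[of j' "n - i"] j by simp
      also have "\<dots> \<le> K * s ^ j' * (M * x ^ i * fps_nth g i * fps_nth g (n - i))"
        using M_le[OF 4(2)] K s nn by (intro mult_left_mono mult_right_mono) auto
      also have "\<dots> = K * M * s ^ j' * x ^ i * (fps_nth g i * fps_nth g (n - i))"
        by (simp add: mult_ac)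
      also have "\<dots> \<le> K * M * s ^ j' * x ^ i * fps_nth (g\<^sup>2) n"
        using le K M s x by (intro mult_left_mono) auto
      also have "\<dots> = K * M / s * (x ^ i * s ^ j) * fps_nth (g\<^sup>2) n"
        using s j by simp
      finally show ?thesis
        by (rule fin) (use d L sqnn in auto)
    qed
  qed
qed

section \<open>The dominant term of the composition\<close>

text \<open>The exponent of u is summed out first: \<open>\<phi> i j\<close> is the l1 norm of
  \<open>F i j\<close>. A common bound on finite weighted sums is the form of summability in i and j
  that the remainder estimate uses.\<close>

lemma analytic_at_u1E:
  assumes "analytic_at_u1 F"
  obtains x s S :: real and \<phi> where "x > 0" "s > 0" "\<And>i j. l1_bound (F i j) (\<phi> i j)"
    "\<And>P. finite P \<Longrightarrow> (\<Sum>(i, j)\<in>P. \<phi> i j * (x ^ i * s ^ j)) \<le> S"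
proof -
  define h where "h x s = (\<lambda>(i, j, k). \<bar>fps_nth (F i j) k\<bar> * x ^ i * s ^ j)" for x s :: real
  obtain x s where x: "x > 0" and s: "s > 0" and h: "h x s summable_on UNIV"
    using assms by (auto simp: analytic_at_u1_def h_def)
  define S where "S = infsum (h x s) UNIV"
  have le: "(\<Sum>(i, j)\<in>P. (\<Sum>k<K. \<bar>fps_nth (F i j) k\<bar>) * (x ^ i * s ^ j)) \<le> S" if "finite P" for P K
  proof -
    let ?r = "\<lambda>((i, j), k). (i, j, k)"
    have "(\<Sum>(i, j)\<in>P. (\<Sum>k<K. \<bar>fps_nth (F i j) k\<bar>) * (x ^ i * s ^ j))
        = (\<Sum>p\<in>P. \<Sum>k<K. h x s (?r (p, k)))"
      by (intro sum.cong) (auto simp: h_def sum_distrib_right mult.assoc)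
    also have "\<dots> = (\<Sum>q\<in>P \<times> {..<K}. h x s (?r q))"
      by (simp add: sum.cartesian_product case_prod_unfold)
    also have "\<dots> = sum (h x s) (?r ` (P \<times> {..<K}))"
      by (subst sum.reindex) (auto simp: inj_on_def)
    also have "\<dots> \<le> S"
      unfolding S_def by (rule finite_sum_le_infsum[OF h]) (use that x s in \<open>auto simp: h_def\<close>)
    finally show ?thesis .
  qed
  define \<phi> where "\<phi> i j = (\<Sum>k. \<bar>fps_nth (F i j) k\<bar>)" for i j
  \<comment> \<open>A singleton index set already bounds the l1 norm of one \<open>F i j\<close>, so
    the limit in \<open>K\<close> may be taken afterwards.\<close>
  have "l1_bound (F i j) (S / (x ^ i * s ^ j))" for i j
    unfolding l1_bound_def using le[of "{(i, j)}"] x s by (simp add: pos_le_divide_eq)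
  then have sm: "summable (\<lambda>k. \<bar>fps_nth (F i j) k\<bar>)" for i j
    by (rule l1_bound_summable)
  show thesis
  proof (rule that[OF x s])
    show "l1_bound (F i j) (\<phi> i j)" for i j
      by (rule l1_boundI_suminf[OF sm]) (simp add: \<phi>_def)
    show "(\<Sum>(i, j)\<in>P. \<phi> i j * (x ^ i * s ^ j)) \<le> S" if "finite P" for P
    proof (rule LIMSEQ_le_const2)
      show "(\<lambda>K. \<Sum>(i, j)\<in>P. (\<Sum>k<K. \<bar>fps_nth (F i j) k\<bar>) * (x ^ i * s ^ j))
          \<longlonglongrightarrow> (\<Sum>(i, j)\<in>P. \<phi> i j * (x ^ i * s ^ j))"
        unfolding case_prod_unfold \<phi>_def
        by (intro tendsto_sum tendsto_mult_right summable_LIMSEQ sm)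
    qed (use le[OF that] in auto)
  qed
qed

text \<open>This isolates the dominant index (0, 1), which lies in the square of indices only when n
  is at least 1.\<close>

lemma subst_y_nth:
  assumes "n \<ge> 1"
  shows "fps_nth (subst_y f g) n = f 0 1 * fps_nth g n +
    (\<Sum>(i, j)\<in>{..n} \<times> {..n} - {(0, 1)}. f i j * fps_nth (g ^ j) (n - i))"
proof -
  have "fps_nth (subst_y f g) n = (\<Sum>(i, j)\<in>{..n} \<times> {..n}. f i j * fps_nth (g ^ j) (n - i))"
    by (simp add: subst_y_def sum.cartesian_product)
  also have "\<dots> = f 0 1 * fps_nth g n +
    (\<Sum>(i, j)\<in>{..n} \<times> {..n} - {(0, 1)}. f i j * fps_nth (g ^ j) (n - i))"
    by (subst sum.remove[of _ "(0, 1)"]) (use assms in auto)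
  finally show ?thesis .
qed

text \<open>A single error sequence serves both the numerator, as a series in u, and the denominator
  at u = 1, since absolute values majorise both remainders.\<close>

lemma l1_bound_subst_y_remainder:
  fixes G :: "real fps fps" and g :: "real fps"
  assumes G: "\<And>n. l1_bound (fps_nth G n) (fps_nth g n)" and F: "analytic_at_u1 F"
    and g0: "fps_nth g 0 = 0" and pos: "\<And>n. n \<ge> 1 \<Longrightarrow> fps_nth g n > 0"
    and ratio: "(\<lambda>n. fps_nth g (n - 1) / fps_nth g n) \<longlonglongrightarrow> 0"
    and sq: "(\<lambda>n. fps_nth (g\<^sup>2) n / fps_nth g n) \<longlonglongrightarrow> 0"
  obtains E where "(\<lambda>n. E n / fps_nth g n) \<longlonglongrightarrow> 0"
    "\<And>n. n \<ge> 1 \<Longrightarrow> l1_bound (fps_nth (subst_y F G) n - F 0 1 * fps_nth G n) (E n)"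
    "\<And>n. n \<ge> 1 \<Longrightarrow>
      \<bar>fps_nth (subst_y (\<lambda>i j. eval_fps (F i j) 1) g) n - eval_fps (F 0 1) 1 * fps_nth g n\<bar> \<le> E n"
proof -
  have nn: "fps_nth g n \<ge> 0" for n using G l1_bound_nonneg by blast
  have nn': "fps_nth (g ^ j) n \<ge> 0" for j n by (rule power_nth_nonneg[OF nn])
  obtain x s S \<phi> where x: "x > 0" and s: "s > 0" and \<phi>: "\<And>i j. l1_bound (F i j) (\<phi> i j)"
    and S: "\<And>P. finite P \<Longrightarrow> (\<Sum>(i, j)\<in>P. \<phi> i j * (x ^ i * s ^ j)) \<le> S"
    by (rule analytic_at_u1E[OF F]) (rule that)
  define d where "d n = fps_nth (g\<^sup>2) n + (1 / x) ^ n" for n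
  have d: "d n \<ge> 0" for n using x nn' by (simp add: d_def)
  obtain L where L: "L > 0" "\<And>i j n. n \<ge> 1 \<Longrightarrow> i \<le> n \<Longrightarrow> (i, j) \<noteq> (0, 1) \<Longrightarrow>
      fps_nth (g ^ j) (n - i) \<le> L * (x ^ i * s ^ j) * d n"
    unfolding d_def by (rule shifted_power_nth_le[OF g0 pos ratio sq x s]) (assumption, blast intro: that)
  \<comment> \<open>The remainder with every \<open>F i j\<close> replaced by its l1 norm and
    \<open>G\<close> by its majorant \<open>g\<close>.\<close>
  define R where "R n = (\<Sum>(i, j)\<in>{..n} \<times> {..n} - {(0, 1)}. \<phi> i j * fps_nth (g ^ j) (n - i))" for n
  have R: "R n \<le> L * S * d n" if "n \<ge> 1" for n
  proof -
    have "R n \<le> (\<Sum>(i, j)\<in>{..n} \<times> {..n} - {(0, 1)}. L * d n * (\<phi> i j * (x ^ i * s ^ j)))"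
      unfolding R_def
    proof (intro sum_mono, unfold case_prod_unfold)
      fix p assume "p \<in> {..n} \<times> {..n} - {(0::nat, 1::nat)}"
      then have "fps_nth (g ^ snd p) (n - fst p) \<le> L * (x ^ fst p * s ^ snd p) * d n"
        by (intro L that) (auto simp: prod_eq_iff)
      from mult_left_mono[OF this l1_bound_nonneg[OF \<phi>[of "fst p" "snd p"]]]
      show "\<phi> (fst p) (snd p) * fps_nth (g ^ snd p) (n - fst p)
          \<le> L * d n * (\<phi> (fst p) (snd p) * (x ^ fst p * s ^ snd p))"
        by (simp add: mult_ac)
    qed
    also have "\<dots> = L * d n * (\<Sum>(i, j)\<in>{..n} \<times> {..n} - {(0, 1)}. \<phi> i j * (x ^ i * s ^ j))"
      by (simp add: sum_distrib_left case_prod_unfold)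
    also have "\<dots> \<le> L * d n * S"
      using L(1) d by (intro mult_left_mono S) auto
    finally show ?thesis by (simp add: mult_ac)
  qed
  show thesis
  proof (rule that[of "\<lambda>n. L * S * d n"])
    have "(\<lambda>n. (1 / x) ^ n / fps_nth g n) \<longlonglongrightarrow> 0"
      using x by (intro power_div_tendsto_0 ratio pos) auto
    from tendsto_mult_right_zero[OF tendsto_add_zero[OF sq this], of "L * S"]
    show "(\<lambda>n. L * S * d n / fps_nth g n) \<longlonglongrightarrow> 0"
      by (simp add: d_def flip: add_divide_distrib)
  next
    fix n :: nat assume n: "n \<ge> 1"
    have "l1_bound (\<Sum>(i, j)\<in>{..n} \<times> {..n} - {(0, 1)}. F i j * fps_nth (G ^ j) (n - i)) (R n)"
      unfolding R_def case_prod_unfold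
      by (intro l1_bound_sum l1_bound_mult \<phi> l1_bound_power_nth G)
    then show "l1_bound (fps_nth (subst_y F G) n - F 0 1 * fps_nth G n) (L * S * d n)"
      unfolding subst_y_nth[OF n] using R[OF n] by (auto intro: l1_bound_mono)
    have "\<bar>\<Sum>(i, j)\<in>{..n} \<times> {..n} - {(0, 1)}. eval_fps (F i j) 1 * fps_nth (g ^ j) (n - i)\<bar> \<le> R n"
      unfolding R_def case_prod_unfold
      by (intro order_trans[OF sum_abs] sum_mono)
         (auto simp: abs_mult nn' intro!: mult_right_mono abs_eval_fps_le[OF \<phi>])
    then show "\<bar>fps_nth (subst_y (\<lambda>i j. eval_fps (F i j) 1) g) n - eval_fps (F 0 1) 1 * fps_nth g n\<bar>
        \<le> L * S * d n"
      unfolding subst_y_nth[OF n] using R[OF n] by auto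
  qed
qed

section \<open>From the dominant term to limits of characteristic functions\<close>

lemma ceval_p_pgf:
  fixes F G n
  defines "T \<equiv> fps_nth (subst_y F G) n - F 0 1 * fps_nth G n"
  assumes F: "l1_bound (F 0 1) A" and G: "l1_bound (fps_nth G n) B" and T: "l1_bound T C"
    and g: "fps_nth (eval_u1 G) n \<noteq> 0" and z: "norm z \<le> 1"
  shows "ceval (p_pgf F G n) z =
    of_real (fps_nth (eval_u1 G) n / p_denom F G n) * ceval (F 0 1) z * ceval (q_pgf G n) z +
    ceval T z / of_real (p_denom F G n)"
proof -
  have FG: "l1_bound (F 0 1 * fps_nth G n) (A * B)" by (rule l1_bound_mult[OF F G])
  have eq: "fps_nth (subst_y F G) n = F 0 1 * fps_nth G n + T" by (simp add: T_def)
  have "ceval (p_pgf F G n) z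
      = of_real (1 / p_denom F G n) * (ceval (F 0 1) z * ceval (fps_nth G n) z + ceval T z)"
    unfolding p_pgf_def eq
    by (simp only: ceval_const_mult[OF l1_bound_add[OF FG T] z] ceval_add[OF FG T z] ceval_mult[OF F G z])
  moreover have "ceval (q_pgf G n) z = of_real (1 / fps_nth (eval_u1 G) n) * ceval (fps_nth G n) z"
    unfolding q_pgf_def by (rule ceval_const_mult[OF G z])
  \<comment> \<open>A vanishing denominator is harmless: division by zero then makes both sides
    0.\<close>
  ultimately show ?thesis using g by (cases "p_denom F G n = 0") (simp_all add: field_simps)
qed

text \<open>Here \<open>z n\<close> stands for \<open>iexp (t / b n)\<close> and \<open>w n\<close>
  for the phase produced by centering with \<open>a n\<close>. Since the phase has modulus 1, it
  does not enlarge the error.\<close>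

lemma char_limit_transfer:
  fixes G :: "real fps fps" and g :: "real fps"
  defines "g \<equiv> eval_u1 G"
  assumes G: "\<And>n. l1_bound (fps_nth G n) (fps_nth g n)" and F: "analytic_at_u1 F"
    and F01: "eval_fps (F 0 1) 1 = 1"
    and g0: "fps_nth g 0 = 0" and pos: "\<And>n. n \<ge> 1 \<Longrightarrow> fps_nth g n > 0"
    and ratio: "(\<lambda>n. fps_nth g (n - 1) / fps_nth g n) \<longlonglongrightarrow> 0"
    and sq: "(\<lambda>n. fps_nth (g\<^sup>2) n / fps_nth g n) \<longlonglongrightarrow> 0"
    and z: "\<And>n. norm (z n) \<le> 1" and w: "\<And>n. norm (w n) \<le> 1"
    and Fz: "(\<lambda>n. ceval (F 0 1) (z n)) \<longlonglongrightarrow> 1"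
    and q: "(\<lambda>n. w n * ceval (q_pgf G n) (z n)) \<longlonglongrightarrow> l"
  shows "(\<lambda>n. w n * ceval (p_pgf F G n) (z n)) \<longlonglongrightarrow> l"
proof -
  obtain E where E: "(\<lambda>n. E n / fps_nth g n) \<longlonglongrightarrow> 0"
    "\<And>n. n \<ge> 1 \<Longrightarrow> l1_bound (fps_nth (subst_y F G) n - F 0 1 * fps_nth G n) (E n)"
    "\<And>n. n \<ge> 1 \<Longrightarrow> \<bar>p_denom F G n - fps_nth g n\<bar> \<le> E n"
    unfolding p_denom_def g_def[symmetric]
    by (rule l1_bound_subst_y_remainder[OF G F g0 pos ratio sq, unfolded F01 mult_1])
       (assumption, blast intro: that)
  obtain A where A: "l1_bound (F 0 1) A"
    by (rule analytic_at_u1E[OF F]) (blast intro: that)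
  \<comment> \<open>The two normalising denominators are asymptotically equal because f01(1) =
    1.\<close>
  define \<rho> where "\<rho> n = p_denom F G n / fps_nth g n" for n
  have "(\<lambda>n. \<rho> n - 1) \<longlonglongrightarrow> 0"
  proof (rule Lim_null_comparison[OF _ E(1)])
    show "\<forall>\<^sub>F n in sequentially. norm (\<rho> n - 1) \<le> E n / fps_nth g n"
      using eventually_ge_at_top[of 1]
    proof eventually_elim
      case (elim n)
      have "\<rho> n - 1 = (p_denom F G n - fps_nth g n) / fps_nth g n"
        using pos[OF elim] by (simp add: \<rho>_def field_simps)
      then show ?case
        using E(3)[OF elim] pos[OF elim] by (simp add: abs_divide divide_right_mono)
    qed
  qed
  then have \<rho>: "\<rho> \<longlonglongrightarrow> 1" by (simp add: LIM_zero_iff)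
  have \<rho>': "(\<lambda>n. inverse (\<rho> n)) \<longlonglongrightarrow> 1"
    using tendsto_inverse[OF \<rho>] by simp
  define T where "T n = fps_nth (subst_y F G) n - F 0 1 * fps_nth G n" for n
  define \<eta> where "\<eta> n = w n * (ceval (T n) (z n) / of_real (p_denom F G n))" for n
  have \<eta>: "\<eta> \<longlonglongrightarrow> 0"
  proof (rule Lim_null_comparison)
    show "(\<lambda>n. E n / fps_nth g n * inverse (\<bar>\<rho> n\<bar>)) \<longlonglongrightarrow> 0"
      using tendsto_mult[OF E(1) tendsto_inverse[OF tendsto_rabs[OF \<rho>]]] by simp
    show "\<forall>\<^sub>F n in sequentially. norm (\<eta> n) \<le> E n / fps_nth g n * inverse (\<bar>\<rho> n\<bar>)"
      using eventually_ge_at_top[of 1]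
    proof eventually_elim
      case (elim n)
      have "norm (ceval (T n) (z n)) \<le> E n"
        unfolding T_def by (rule norm_ceval_le[OF E(2)[OF elim] z])
      then have "norm (w n) * (norm (ceval (T n) (z n)) / \<bar>p_denom F G n\<bar>) \<le> 1 * (E n / \<bar>p_denom F G n\<bar>)"
        by (intro mult_mono divide_right_mono w) auto
      then show ?case
        using pos[OF elim] by (simp add: \<eta>_def \<rho>_def norm_mult norm_divide field_simps)
    qed
  qed
  have "(\<lambda>n. of_real (inverse (\<rho> n)) * ceval (F 0 1) (z n) * (w n * ceval (q_pgf G n) (z n)) + \<eta> n)
      \<longlonglongrightarrow> of_real 1 * 1 * l + 0"
    by (intro tendsto_intros \<rho>' Fz q \<eta>)
  moreover have "\<forall>\<^sub>F n in sequentially.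
      of_real (inverse (\<rho> n)) * ceval (F 0 1) (z n) * (w n * ceval (q_pgf G n) (z n)) + \<eta> n
        = w n * ceval (p_pgf F G n) (z n)"
    using eventually_ge_at_top[of 1]
  proof eventually_elim
    case (elim n)
    show ?case
      using ceval_p_pgf[where F = F and G = G and n = n, OF A G E(2)[OF elim] _ z] pos[OF elim]
      by (simp add: \<rho>_def \<eta>_def T_def g_def algebra_simps)
  qed
  ultimately show ?thesis by (simp add: Lim_transform_eventually)
qed

text \<open>Without scaling, the limit picks up the factor f01(exp(it)), which f01(1) = 1 alone does
  not remove. So either \<open>F 0 1\<close> is the constant series 1, or \<open>b n\<close> tends
  to infinity and moves the evaluation point to 1. The ratio condition bounds growth only from
  below: after a jump to a huge \<open>g\<close> coefficient at m, slow growth could leave its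
  square larger than the coefficient at 2m, which \<open>G_middle\<close> excludes. For small n,
  \<open>p_denom\<close> may vanish, so \<open>X_pgf\<close> is an eventual condition.\<close>

theorem mainTheorem5:
  fixes G :: "real fps fps"
    and F :: "nat \<Rightarrow> nat \<Rightarrow> real fps"
    and \<sigma> :: real and r :: nat
    and MX :: "nat \<Rightarrow> 'a measure" and X :: "nat \<Rightarrow> 'a \<Rightarrow> nat"
    and MY :: "nat \<Rightarrow> 'b measure" and Y :: "nat \<Rightarrow> 'b \<Rightarrow> nat"
    and N :: "'c measure" and Ylim :: "'c \<Rightarrow> real"
  assumes G_0: "fps_nth G 0 = 0"
    and G_nonneg: "\<And>n k. fps_nth (fps_nth G n) k \<ge> 0"
    and G_summable: "\<And>n. summable (fps_nth (fps_nth G n))"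
    and G_pos: "\<And>n. n \<ge> 1 \<Longrightarrow> fps_nth (eval_u1 G) n > 0"
    and \<sigma>_pos: "\<sigma> > 0"
    and G_ratio: "(\<lambda>n. fps_nth (eval_u1 G) (n - 1) / fps_nth (eval_u1 G) n)
                    \<in> O(\<lambda>n. real n powr (- \<sigma>))"
    and G_middle: "(\<lambda>n. \<Sum>k = r..n - r. fps_nth (eval_u1 G) k * fps_nth (eval_u1 G) (n - k))
                     \<in> o(\<lambda>n. fps_nth (eval_u1 G) n)"
    and F_01: "eval_fps (F 0 1) 1 = 1"
    and F_analytic: "analytic_at_u1 F"
    and X_pgf: "\<forall>\<^sub>F n in sequentially. has_pgf (MX n) (X n) (p_pgf F G n)"
    and Y_pgf: "\<And>n. n \<ge> 1 \<Longrightarrow> has_pgf (MY n) (Y n) (q_pgf G n)"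
    and Ylim_prob: "prob_space N" and Ylim_rv: "Ylim \<in> borel_measurable N"
  shows "(F 0 1 = 1 \<longrightarrow>
            converges_in_distribution MY (\<lambda>n \<omega>. real (Y n \<omega>)) N Ylim \<longrightarrow>
            converges_in_distribution MX (\<lambda>n \<omega>. real (X n \<omega>)) N Ylim) \<and>
         (\<forall>a b :: nat \<Rightarrow> real. filterlim b at_top sequentially \<longrightarrow>
            converges_in_distribution MY (\<lambda>n \<omega>. (real (Y n \<omega>) - a n) / b n) N Ylim \<longrightarrow>
            converges_in_distribution MX (\<lambda>n \<omega>. (real (X n \<omega>) - a n) / b n) N Ylim)"
proof -
  define g where "g = eval_u1 G"
  have g0: "fps_nth g 0 = 0" by (simp add: g_def eval_u1_def G_0)
  have pos: "fps_nth g n > 0" if "n \<ge> 1" for n using G_pos[OF that] by (simp add: g_def)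
  have G: "l1_bound (fps_nth G n) (fps_nth g n)" for n
    using G_summable[of n] G_nonneg[of n]
    by (intro l1_boundI_suminf) (auto simp: g_def eval_u1_def eval_fps_def)
  have "(\<lambda>n. real n powr (- \<sigma>)) \<longlonglongrightarrow> 0"
    using \<sigma>_pos by (intro tendsto_neg_powr filterlim_real_sequentially) auto
  then have ratio: "(\<lambda>n. fps_nth g (n - 1) / fps_nth g n) \<longlonglongrightarrow> 0"
    using smalloD_tendsto[OF landau_o.big_small_trans[OF G_ratio smalloI_tendsto[of _ "\<lambda>_. 1"]]]
    by (simp add: g_def)
  have sq: "(\<lambda>n. fps_nth (g\<^sup>2) n / fps_nth g n) \<longlonglongrightarrow> 0"
    by (rule convolution_square_smallo[OF g0 pos ratio]) (use G_middle in \<open>auto simp: g_def\<close>)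
  have Y_pgf': "\<forall>\<^sub>F n in sequentially. has_pgf (MY n) (Y n) (q_pgf G n)"
    using eventually_ge_at_top[of 1] by eventually_elim (rule Y_pgf)
  \<comment> \<open>Both conclusions reduce to one property of the scaling: the factor f01 tends to
    1 along the evaluation points.\<close>
  have transfer: "converges_in_distribution MX (\<lambda>n \<omega>. (real (X n \<omega>) - a n) / b n) N Ylim"
    if Fz: "\<And>t. (\<lambda>n. ceval (F 0 1) (iexp (t / b n))) \<longlonglongrightarrow> 1"
      and Y: "converges_in_distribution MY (\<lambda>n \<omega>. (real (Y n \<omega>) - a n) / b n) N Ylim" for a b
  proof -
    have X_rv: "\<forall>\<^sub>F n in sequentially. prob_space (MX n) \<and>
        (\<lambda>\<omega>. (real (X n \<omega>) - a n) / b n) \<in> borel_measurable (MX n)"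
      using X_pgf by eventually_elim (rule has_pgf_normalized_rv)
    have Y_rv: "\<forall>\<^sub>F n in sequentially. prob_space (MY n) \<and>
        (\<lambda>\<omega>. (real (Y n \<omega>) - a n) / b n) \<in> borel_measurable (MY n)"
      using Y_pgf' by eventually_elim (rule has_pgf_normalized_rv)
    show ?thesis
      unfolding converges_in_distribution_iff_char[OF X_rv Ylim_prob Ylim_rv]
    proof
      fix t
      let ?l = "char (distr N borel Ylim) t"
      have "(\<lambda>n. char (distr (MY n) borel (\<lambda>\<omega>. (real (Y n \<omega>) - a n) / b n)) t) \<longlonglongrightarrow> ?l"
        using Y converges_in_distribution_iff_char[OF Y_rv Ylim_prob Ylim_rv] by blast
      moreover have "\<forall>\<^sub>F n in sequentially.
          char (distr (MY n) borel (\<lambda>\<omega>. (real (Y n \<omega>) - a n) / b n)) t =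
          iexp (- (t * a n / b n)) * ceval (q_pgf G n) (iexp (t / b n))"
        using Y_pgf' by eventually_elim (rule char_distr_has_pgf)
      ultimately have "(\<lambda>n. iexp (- (t * a n / b n)) * ceval (q_pgf G n) (iexp (t / b n))) \<longlonglongrightarrow> ?l"
        by (rule Lim_transform_eventually)
      then have "(\<lambda>n. iexp (- (t * a n / b n)) * ceval (p_pgf F G n) (iexp (t / b n))) \<longlonglongrightarrow> ?l"
        by (intro char_limit_transfer[OF G[unfolded g_def] F_analytic F_01 _ _ _ _ _ _ Fz])
           (use g0 pos ratio sq in \<open>auto simp: g_def\<close>)
      moreover have "\<forall>\<^sub>F n in sequentially.
          iexp (- (t * a n / b n)) * ceval (p_pgf F G n) (iexp (t / b n)) =
          char (distr (MX n) borel (\<lambda>\<omega>. (real (X n \<omega>) - a n) / b n)) t"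
        using X_pgf by eventually_elim (rule char_distr_has_pgf[symmetric])
      ultimately show "(\<lambda>n. char (distr (MX n) borel (\<lambda>\<omega>. (real (X n \<omega>) - a n) / b n)) t) \<longlonglongrightarrow> ?l"
        by (rule Lim_transform_eventually)
    qed
  qed
  show ?thesis
  proof (intro conjI allI impI)
    assume "F 0 1 = 1" and "converges_in_distribution MY (\<lambda>n \<omega>. real (Y n \<omega>)) N Ylim"
    moreover have "ceval 1 z = 1" for z
      using sums_unique[OF sums_finite[of "{0}" "\<lambda>k. of_real (fps_nth (1::real fps) k) * z ^ k"]]
      by (simp add: ceval_def)
    ultimately show "converges_in_distribution MX (\<lambda>n \<omega>. real (X n \<omega>)) N Ylim"
      \<comment> \<open>The unscaled claim is the case of centering 0 and scale 1, where the factor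
        is identically 1.\<close>
      using transfer[of "\<lambda>_. 1" "\<lambda>_. 0"] by simp
  next
    fix a b :: "nat \<Rightarrow> real"
    assume b: "filterlim b at_top sequentially"
      and Y: "converges_in_distribution MY (\<lambda>n \<omega>. (real (Y n \<omega>) - a n) / b n) N Ylim"
    obtain A where A: "l1_bound (F 0 1) A"
      by (rule analytic_at_u1E[OF F_analytic]) (blast intro: that)
    show "converges_in_distribution MX (\<lambda>n \<omega>. (real (X n \<omega>) - a n) / b n) N Ylim"
    proof (rule transfer[OF _ Y])
      fix t
      have "(\<lambda>n. t / b n) \<longlonglongrightarrow> 0"
        by (rule tendsto_divide_0[OF tendsto_const filterlim_at_top_imp_at_infinity[OF b]])
      then have "(\<lambda>n. iexp (t / b n)) \<longlonglongrightarrow> iexp 0"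
        by (intro tendsto_intros)
      then have "(\<lambda>n. iexp (t / b n)) \<longlonglongrightarrow> 1" by simp
      then have "(\<lambda>n. ceval (F 0 1) (iexp (t / b n))) \<longlonglongrightarrow> ceval (F 0 1) 1"
        by (rule continuous_on_tendsto_compose[OF continuous_on_ceval[OF A]]) auto
      then show "(\<lambda>n. ceval (F 0 1) (iexp (t / b n))) \<longlonglongrightarrow> 1"
        using ceval_1[OF A] F_01 by simp
    qed
  qed
qed

end
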